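(* Let $M$ be a deterministic Markov decision process with nonempty state space $\mathcal{X}$, nonempty control space $\mathcal{U}$, dynamics $f:\mathcal{X}\times\mathcal{U}\to\mathcal{X}$ and discount factor $\gamma\in[0,1)$, and let $\mathcal{X}_{\mathrm{unsafe}}\subseteq\mathcal{X}$ be a specified set of unsafe states. Suppose that (a) early termination is employed with termination condition $\mathcal{X}_{\mathrm{unsafe}}$; (b) the reward has the safety-preserving structure, i.e. $r(x,u,x')=0$ if $x'\in\mathcal{X}_{\mathrm{unsafe}}$ and $r(x,u,x')=1$ otherwise; and (c) there is an upper bound $H\in\mathbb{N}$ on irrecoverability, i.e. every $x\in\mathcal{X}_{\mathrm{irrec}}$ is $k$-irrecoverable for some $k\in\mathbb{N}$ and the minimal such $k$, denoted $k_x$, satisfies $k_x\le H$. Let $V^*$ be the optimal value function, and let $V:\mathcal{X}\to\mathbb{R}$ and $\epsilon\in\mathbb{R}$ satisfy (d) $\sup_{x\in\mathcal{X}}|V(x)-V^*(x)|<\epsilon$ and (e) $\epsilon<\frac{\gamma^H}{2(1-\gamma)}$. Then for every $R\in\left(\frac{1-\gamma^H}{1-\gamma}+\epsilon,\ \frac{1}{1-\gamma}-\epsilon\right]$ and every $\alpha\in\left[\frac{2\epsilon}{\frac{1}{1-\gamma}+\epsilon-R},\,1\right]$, the function $h=V-R$ is a control barrier function against $\mathcal{X}_{\mathrm{unsafe}}$ with parameter $\alpha$.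
   Context: Safe and irrecoverable states: a state $x$ is indefinitely safe if it belongs to some set $S\subseteq\mathcal{X}\setminus\mathcal{X}_{\mathrm{unsafe}}$ for which there is a controller $\pi:\mathcal{X}\to\mathcal{U}$ such that $S$ is forward-invariant under $f_\pi(x)=f(x,\pi(x))$ (i.e. $x\in S$ implies $f_\pi(x)\in S$). $\mathcal{X}_{\mathrm{safe}}$ is the set of all indefinitely safe states, and $\mathcal{X}_{\mathrm{irrec}}=\mathcal{X}\setminus(\mathcal{X}_{\mathrm{unsafe}}\cup\mathcal{X}_{\mathrm{safe}})$ is the set of irrecoverable states. A state $x$ is $k$-irrecoverable if, for every choice of controls, the trajectory started at $x$ enters $\mathcal{X}_{\mathrm{unsafe}}$ within $k$ timesteps. Value function: early termination means that the episode stops, and no further reward is collected, as soon as a state in $\mathcal{X}_{\mathrm{unsafe}}$ is reached. Thus $V^*(x)=0$ for $x\in\mathcal{X}_{\mathrm{unsafe}}$, and for $x\notin\mathcal{X}_{\mathrm{unsafe}}$, $V^*(x)$ is the supremum over control sequences $(u_t)_{t\ge 0}$ of the discounted return $\sum_{t} \gamma^t r(x_t,u_t,x_{t+1})$, where $x_0=x$, $x_{t+1}=f(x_t,u_t)$, and the sum runs over all $t\ge 0$ such that none of $x_0,\dots,x_t$ lies in $\mathcal{X}_{\mathrm{unsafe}}$. Control barrier function: for $\alpha\in(0,1]$, a function $h:\mathcal{X}\to\mathbb{R}$ is a (discrete-time) control barrier function against $\mathcal{X}_{\mathrm{unsafe}}$ with parameter $\alpha$ if (i) $h(x)<0$ for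 all $x\in\mathcal{X}_{\mathrm{unsafe}}$, and (ii) for all $x\in\mathcal{X}$ with $h(x)\ge 0$, $\sup_{u\in\mathcal{U}} h(f(x,u))\ge(1-\alpha)h(x)$. *)

theory Defs
  imports Complex_Main "HOL-Library.Extended_Real"
begin

text \<open>
  A deterministic Markov decision process is given by its dynamics
  \<open>f :: 'x \<Rightarrow> 'u \<Rightarrow> 'x\<close>, its reward \<open>r :: 'x \<Rightarrow> 'u \<Rightarrow> 'x \<Rightarrow> real\<close> and a discount factor \<open>\<gamma>\<close>;
  the state space and the control space are the types \<open>'x\<close> and \<open>'u\<close>, which are nonempty.
\<close>

primrec trajectory :: "('x \<Rightarrow> 'u \<Rightarrow> 'x) \<Rightarrow> 'x \<Rightarrow> (nat \<Rightarrow> 'u) \<Rightarrow> nat \<Rightarrow> 'x" where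
  "trajectory f x u 0 = x"
| "trajectory f x u (Suc t) = f (trajectory f x u t) (u t)"

definition forward_invariant :: "('x \<Rightarrow> 'x) \<Rightarrow> 'x set \<Rightarrow> bool" where
  "forward_invariant g S \<longleftrightarrow> (\<forall>x\<in>S. g x \<in> S)"

definition safe_states :: "('x \<Rightarrow> 'u \<Rightarrow> 'x) \<Rightarrow> 'x set \<Rightarrow> 'x set" where
  "safe_states f unsafe =
     {x. \<exists>S. S \<subseteq> UNIV - unsafe \<and> (\<exists>\<pi>. forward_invariant (\<lambda>y. f y (\<pi> y)) S) \<and> x \<in> S}"

definition irrecoverable_states :: "('x \<Rightarrow> 'u \<Rightarrow> 'x) \<Rightarrow> 'x set \<Rightarrow> 'x set" where
  "irrecoverable_states f unsafe = UNIV - (unsafe \<union> safe_states f unsafe)"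

definition k_irrecoverable :: "('x \<Rightarrow> 'u \<Rightarrow> 'x) \<Rightarrow> 'x set \<Rightarrow> nat \<Rightarrow> 'x \<Rightarrow> bool" where
  "k_irrecoverable f unsafe k x \<longleftrightarrow> (\<forall>u. \<exists>t\<le>k. trajectory f x u t \<in> unsafe)"

text \<open>Only meaningful if \<open>x\<close> is \<open>k\<close>-irrecoverable for some \<open>k\<close>.\<close>

definition irrecoverability_time :: "('x \<Rightarrow> 'u \<Rightarrow> 'x) \<Rightarrow> 'x set \<Rightarrow> 'x \<Rightarrow> nat" where
  "irrecoverability_time f unsafe x = (LEAST k. k_irrecoverable f unsafe k x)"

definition irrecoverability_bound :: "('x \<Rightarrow> 'u \<Rightarrow> 'x) \<Rightarrow> 'x set \<Rightarrow> nat \<Rightarrow> bool" where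
  "irrecoverability_bound f unsafe H \<longleftrightarrow>
     (\<forall>x\<in>irrecoverable_states f unsafe.
        (\<exists>k. k_irrecoverable f unsafe k x) \<and> irrecoverability_time f unsafe x \<le> H)"

definition safety_preserving_reward :: "'x set \<Rightarrow> ('x \<Rightarrow> 'u \<Rightarrow> 'x \<Rightarrow> real) \<Rightarrow> bool" where
  "safety_preserving_reward unsafe r \<longleftrightarrow>
     (\<forall>x u x'. r x u x' = (if x' \<in> unsafe then 0 else 1))"

text \<open>
  Early termination: the reward of step \<open>t\<close> counts only if none of the states at times
  \<open>0, \<dots>, t\<close> is unsafe; the transition that enters the unsafe set is still rewarded.
\<close>

definition discounted_return ::
  "('x \<Rightarrow> 'u \<Rightarrow> 'x) \<Rightarrow> ('x \<Rightarrow> 'u \<Rightarrow> 'x \<Rightarrow> real) \<Rightarrow> real \<Rightarrow> 'x set \<Rightarrow> 'x \<Rightarrow> (nat \<Rightarrow> 'u) \<Rightarrow> real" where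
  "discounted_return f r \<gamma> unsafe x u =
     (\<Sum>t. if \<forall>s\<le>t. trajectory f x u s \<notin> unsafe
          then \<gamma> ^ t * r (trajectory f x u t) (u t) (trajectory f x u (Suc t))
          else 0)"

text \<open>
  The series and the real supremum are meant for bounded \<open>r\<close> and \<open>0 \<le> \<gamma> < 1\<close>, where the
  series converges absolutely and the returns are bounded uniformly in the controls.
\<close>

definition optimal_value ::
  "('x \<Rightarrow> 'u \<Rightarrow> 'x) \<Rightarrow> ('x \<Rightarrow> 'u \<Rightarrow> 'x \<Rightarrow> real) \<Rightarrow> real \<Rightarrow> 'x set \<Rightarrow> 'x \<Rightarrow> real" where
  "optimal_value f r \<gamma> unsafe x =
     (if x \<in> unsafe then 0 else (SUP u. discounted_return f r \<gamma> unsafe x u))"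

text \<open>
  The supremum is taken in the extended reals, since \<open>h\<close> may be unbounded on the successors
  of a state.
\<close>

definition control_barrier_function ::
  "('x \<Rightarrow> 'u \<Rightarrow> 'x) \<Rightarrow> 'x set \<Rightarrow> real \<Rightarrow> ('x \<Rightarrow> real) \<Rightarrow> bool" where
  "control_barrier_function f unsafe \<alpha> h \<longleftrightarrow>
     0 < \<alpha> \<and> \<alpha> \<le> 1 \<and>
     (\<forall>x\<in>unsafe. h x < 0) \<and>
     (\<forall>x. h x \<ge> 0 \<longrightarrow> (SUP u. ereal (h (f x u))) \<ge> ereal ((1 - \<alpha>) * h x))"

end

(* A state is either unsafe, recoverable forever, or forced into the unsafe set within H steps.
   With the safety-preserving reward the optimal value is 0 in the first case, exactly 1/(1-\<gamma>) in
   the second and at most (1-\<gamma>^H)/(1-\<gamma>) in the third, so a superlevel set of V at a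
   level R inside the gap consists of safe states only. A safe state has a safe successor, where V
   again exceeds 1/(1-\<gamma>) - \<epsilon>; the lower bound on \<alpha> absorbs the error 2\<epsilon>. *)

theory Submission
  imports Defs
begin

text \<open>The reward factor vanishes exactly when the successor is unsafe, so it merges with the
  termination test and moves its horizon from \<open>t\<close> to \<open>Suc t\<close>.\<close>

lemma discounted_return_safety_preserving:
  assumes "safety_preserving_reward unsafe r"
  shows "discounted_return f r \<gamma> unsafe x u =
    (\<Sum>t. if \<forall>s\<le>Suc t. trajectory f x u s \<notin> unsafe then \<gamma> ^ t else 0)"
  unfolding discounted_return_def
proof (rule suminf_cong)
  fix t
  show "(if \<forall>s\<le>t. trajectory f x u s \<notin> unsafe
          then \<gamma> ^ t * r (trajectory f x u t) (u t) (trajectory f x u (Suc t)) else 0) =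
    (if \<forall>s\<le>Suc t. trajectory f x u s \<notin> unsafe then \<gamma> ^ t else 0)"
    using assms unfolding safety_preserving_reward_def le_Suc_eq
    by (auto simp del: trajectory.simps)
qed

lemma discounted_return_le:
  assumes "0 \<le> \<gamma>" "\<gamma> < 1" "safety_preserving_reward unsafe r"
  shows "discounted_return f r \<gamma> unsafe x u \<le> 1 / (1 - \<gamma>)"
proof -
  let ?a = "\<lambda>t. if \<forall>s\<le>Suc t. trajectory f x u s \<notin> unsafe then \<gamma> ^ t else 0"
  have geometric: "summable (\<lambda>t. \<gamma> ^ t)"
    using assms by (simp add: summable_geometric)
  have "summable ?a"
    by (rule summable_comparison_test'[OF geometric]) (use assms in auto)
  then have "suminf ?a \<le> (\<Sum>t. \<gamma> ^ t)"
    by (rule suminf_le[rotated, OF _ geometric]) (use assms in auto)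
  then show ?thesis
    using assms by (simp add: discounted_return_safety_preserving suminf_geometric)
qed

lemma discounted_return_le_if_unsafe_reached:
  assumes "0 \<le> \<gamma>" "\<gamma> < 1" "safety_preserving_reward unsafe r"
    and "t \<le> H" "trajectory f x u t \<in> unsafe"
  shows "discounted_return f r \<gamma> unsafe x u \<le> (1 - \<gamma> ^ H) / (1 - \<gamma>)"
proof -
  let ?a = "\<lambda>t. if \<forall>s\<le>Suc t. trajectory f x u s \<notin> unsafe then \<gamma> ^ t else 0"
  \<comment> \<open>Term \<open>n\<close> can be nonzero only if all states through time
    \<open>Suc n\<close> avoid the unsafe set, so a visit at time \<open>t \<le> H\<close> kills
    every term with \<open>n \<ge> H\<close>.\<close>
  have "?a n = 0" if "n \<notin> {..<H}" for n
  proof -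
    have "t \<le> Suc n" using that assms(4) by simp
    then show ?thesis using assms(5) by auto
  qed
  then have "suminf ?a = (\<Sum>n<H. ?a n)"
    by (intro suminf_finite) auto
  also have "\<dots> \<le> (\<Sum>n<H. \<gamma> ^ n)"
    using assms(1) by (intro sum_mono) auto
  also have "\<dots> = (1 - \<gamma> ^ H) / (1 - \<gamma>)"
    using assms(2) by (simp add: sum_gp_strict)
  finally show ?thesis
    using assms(3) by (simp only: discounted_return_safety_preserving)
qed

text \<open>The time of the first unsafe visit may vary with the controls, but \<open>H\<close> does
  not, so the bound on the returns is uniform and passes to the supremum.\<close>

lemma optimal_value_irrecoverable_le:
  assumes "0 \<le> \<gamma>" "\<gamma> < 1" "safety_preserving_reward unsafe r"
    and "irrecoverability_bound f unsafe H" "x \<in> irrecoverable_states f unsafe"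
  shows "optimal_value f r \<gamma> unsafe x \<le> (1 - \<gamma> ^ H) / (1 - \<gamma>)"
proof -
  have "\<exists>k. k_irrecoverable f unsafe k x"
    using assms(4,5) unfolding irrecoverability_bound_def by blast
  then have "k_irrecoverable f unsafe (irrecoverability_time f unsafe x) x"
    unfolding irrecoverability_time_def by (rule LeastI_ex)
  moreover have "irrecoverability_time f unsafe x \<le> H"
    using assms(4,5) unfolding irrecoverability_bound_def by blast
  ultimately have "\<exists>t\<le>H. trajectory f x u t \<in> unsafe" for u
    unfolding k_irrecoverable_def by (meson le_trans)
  then have "discounted_return f r \<gamma> unsafe x u \<le> (1 - \<gamma> ^ H) / (1 - \<gamma>)" for u
    using discounted_return_le_if_unsafe_reached[OF assms(1-3)] by blast
  then have "(SUP u. discounted_return f r \<gamma> unsafe x u) \<le> (1 - \<gamma> ^ H) / (1 - \<gamma>)"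
    by (intro cSUP_least) auto
  then show ?thesis
    using assms(5) by (simp add: optimal_value_def irrecoverable_states_def)
qed

lemma optimal_value_safe:
  assumes "0 \<le> \<gamma>" "\<gamma> < 1" "safety_preserving_reward unsafe r"
    and "x \<in> safe_states f unsafe"
  shows "optimal_value f r \<gamma> unsafe x = 1 / (1 - \<gamma>)"
proof -
  obtain S \<pi> where S: "S \<subseteq> UNIV - unsafe" "x \<in> S"
    and inv: "forward_invariant (\<lambda>y. f y (\<pi> y)) S"
    using assms(4) unfolding safe_states_def by blast
  \<comment> \<open>Returns are defined for open-loop control sequences, so the feedback law
    \<open>\<pi>\<close> is unrolled along its own closed-loop orbit, which never leaves
    \<open>S\<close>.\<close>
  define u where "u t = \<pi> (((\<lambda>y. f y (\<pi> y)) ^^ t) x)" for t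
  have closed_loop: "trajectory f x u t = ((\<lambda>y. f y (\<pi> y)) ^^ t) x" for t
    by (induction t) (simp_all add: u_def)
  have "((\<lambda>y. f y (\<pi> y)) ^^ t) x \<in> S" for t
    using S(2) inv by (induction t) (auto simp: forward_invariant_def)
  then have "trajectory f x u t \<notin> unsafe" for t
    using S(1) closed_loop by auto
  then have attained: "discounted_return f r \<gamma> unsafe x u = 1 / (1 - \<gamma>)"
    using assms(1-3) by (simp add: discounted_return_safety_preserving suminf_geometric)
  \<comment> \<open>The full geometric series bounds every return and is attained by the unrolled
    controls, so the supremum is a maximum.\<close>
  have "(SUP u. discounted_return f r \<gamma> unsafe x u) = 1 / (1 - \<gamma>)"
    by (rule cSup_eq_maximum)
      (use attained[symmetric] discounted_return_le[OF assms(1-3)] in auto)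
  moreover have "x \<notin> unsafe" using S by auto
  ultimately show ?thesis by (simp add: optimal_value_def)
qed

text \<open>The invariant set and the controller that certify \<open>x\<close> also certify its
  successor under that controller.\<close>

lemma safe_states_successor:
  assumes "x \<in> safe_states f unsafe"
  obtains u where "f x u \<in> safe_states f unsafe"
  using assms unfolding safe_states_def forward_invariant_def by blast

theorem theorem3p2:
  fixes f :: "'x \<Rightarrow> 'u \<Rightarrow> 'x"
    and r :: "'x \<Rightarrow> 'u \<Rightarrow> 'x \<Rightarrow> real"
    and \<gamma> \<epsilon> R \<alpha> :: real
    and unsafe :: "'x set"
    and H :: nat
    and V :: "'x \<Rightarrow> real"
  assumes "0 \<le> \<gamma>" and "\<gamma> < 1"
    and "safety_preserving_reward unsafe r"
    and "irrecoverability_bound f unsafe H"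
    and "(SUP x. ereal \<bar>V x - optimal_value f r \<gamma> unsafe x\<bar>) < ereal \<epsilon>"
    and "\<epsilon> < \<gamma> ^ H / (2 * (1 - \<gamma>))"
    and "R \<in> {(1 - \<gamma> ^ H) / (1 - \<gamma>) + \<epsilon> <.. 1 / (1 - \<gamma>) - \<epsilon>}"
    and "\<alpha> \<in> {2 * \<epsilon> / (1 / (1 - \<gamma>) + \<epsilon> - R) .. 1}"
  shows "control_barrier_function f unsafe \<alpha> (\<lambda>x. V x - R)"
proof -
  let ?V = "optimal_value f r \<gamma> unsafe"
  \<comment> \<open>On safe states \<open>V x - R\<close> differs from
    \<open>1 / (1 - \<gamma>) - R\<close> by less than \<open>\<epsilon>\<close>, hence lies between
    \<open>D - 2 * \<epsilon>\<close> and \<open>D\<close>.\<close>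
  define D where "D = 1 / (1 - \<gamma>) + \<epsilon> - R"
  have close: "\<bar>V x - ?V x\<bar> < \<epsilon>" for x
  proof -
    have "ereal \<bar>V x - ?V x\<bar> \<le> (SUP x. ereal \<bar>V x - ?V x\<bar>)"
      by (rule SUP_upper) simp
    then have "ereal \<bar>V x - ?V x\<bar> < ereal \<epsilon>"
      using assms(5) by (rule le_less_trans)
    then show ?thesis by simp
  qed
  have eps: "0 < \<epsilon>"
    using close[of undefined] by linarith
  have R: "(1 - \<gamma> ^ H) / (1 - \<gamma>) + \<epsilon> < R" "R \<le> 1 / (1 - \<gamma>) - \<epsilon>"
    using assms(7) by auto
  have "\<gamma> ^ H \<le> 1"
    using assms(1,2) by (simp add: power_le_one)
  then have "0 \<le> (1 - \<gamma> ^ H) / (1 - \<gamma>)"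
    using assms(2) by simp
  \<comment> \<open>This puts unsafe states below the level: there \<open>?V\<close> is 0, so
    \<open>V\<close> stays under \<open>\<epsilon>\<close>.\<close>
  with R have R_gt: "\<epsilon> < R" by linarith
  have D: "2 * \<epsilon> \<le> D" "0 < D"
    using R(2) eps by (auto simp: D_def)
  have alpha: "2 * \<epsilon> / D \<le> \<alpha>" "\<alpha> \<le> 1"
    using assms(8) by (auto simp: D_def)
  have "0 < 2 * \<epsilon> / D"
    using eps D(2) by simp
  with alpha have alpha_pos: "0 < \<alpha>" by linarith
  have alpha_D: "2 * \<epsilon> \<le> \<alpha> * D"
    using alpha(1) D(2) by (simp add: pos_divide_le_eq)
  have neg: "V x - R < 0" if "x \<in> unsafe" for x
    using that close[of x] R_gt by (simp add: optimal_value_def)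
  have "ereal ((1 - \<alpha>) * (V x - R)) \<le> (SUP u. ereal (V (f x u) - R))" if "0 \<le> V x - R" for x
  proof -
    have "x \<notin> unsafe"
      using neg that by fastforce
    \<comment> \<open>An irrecoverable state would have \<open>V x\<close> below
      \<open>(1 - \<gamma> ^ H) / (1 - \<gamma>) + \<epsilon>\<close>, which is less than
      \<open>R\<close>.\<close>
    moreover have "x \<notin> irrecoverable_states f unsafe"
      using optimal_value_irrecoverable_le[OF assms(1-4), of x] close[of x] R(1) that by linarith
    ultimately have safe: "x \<in> safe_states f unsafe"
      unfolding irrecoverable_states_def by blast
    then obtain u where u: "f x u \<in> safe_states f unsafe"
      by (rule safe_states_successor)
    have "V x - R \<le> D"
      using optimal_value_safe[OF assms(1-3) safe] close[of x] by (simp add: D_def)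
    then have "(1 - \<alpha>) * (V x - R) \<le> (1 - \<alpha>) * D"
      using alpha(2) by (intro mult_left_mono) auto
    \<comment> \<open>The bound on \<open>\<alpha>\<close> is used here: shrinking the largest
      possible value \<open>D\<close> by \<open>\<alpha> * D\<close> brings it down to the
      guaranteed value \<open>D - 2 * \<epsilon>\<close> at the safe successor or lower.\<close>
    also have "\<dots> \<le> D - 2 * \<epsilon>"
      using alpha_D by (simp add: algebra_simps)
    also have "\<dots> \<le> V (f x u) - R"
      using optimal_value_safe[OF assms(1-3) u] close[of "f x u"] by (simp add: D_def)
    finally show ?thesis
      by (intro SUP_upper2[of u]) auto
  qed
  then show ?thesis
    using alpha(2) alpha_pos neg by (simp add: control_barrier_function_def)
qed

end
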